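(* Fix $\lambda\ge 0$, $\mu\geq 0$, $x\in H$ and let $y=\alpha(x)+\nu$ with $\nu\in\mathbb{R}^m$. Assume the frame $\{f_1,\dots,f_m\}$ satisfies Assumption A and let $A_3>0$ denote a constant such that $$A_3 \|X-Y\|_1^2 \leq \|\mathcal{A}(X)-\mathcal{A}(Y)\|^2\quad\text{for all }X\in\mathcal{S}^{1,1},\ Y\in\mathcal{S}^{1,0}.$$ Assume the optimization procedure finds a pair $u,v\in H$ so that $J(u,v,\lambda,\mu)\leq J(x,x,\lambda,\mu)$. Then $$\|\llbracket u,v\rrbracket-xx^*\|_1 \leq \frac{2\lambda}{A_3}+2\sqrt{\frac{\lambda^2}{A_3^2} + \frac{\|\nu\|^2}{A_3}} \leq \frac{4\lambda}{A_3} + \frac{2\|\nu\|}{\sqrt{A_3}}.$$ Let $\llbracket u,v\rrbracket=a_1e_1e_1^*-a_2e_2e_2^*$, with real $a_1,a_2\geq 0$ and $\{e_1,e_2\}$ an orthonormal set in $H$, be its spectral decomposition. Assume an oracle provides the global phase $\varphi_0$ so that $e^{i\varphi_0}=\frac{\langle x,e_1\rangle}{|\langle x,e_1\rangle|}$. Set $\hat{x}= e^{i\varphi_0} \sqrt{a_1}\,e_1$. Then $$\|x-\hat{x}\|^2 \leq \|\llbracket u,v\rrbracket-xx^*\|_1 + a_2,$$ and, for $\mu>0$, $$\|\llbracket u,v\rrbracket-xx^*\|_1 + a_2\leq \frac{4\lambda}{A_3}+\frac{2\|\nu\|}{\sqrt{A_3}} + \frac{\|\nu\|^2}{4\mu}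 + \frac{\lambda\|x\|^2}{2\mu}.$$ If, additionally, $J(u,v,\lambda,\mu)\leq J(0,0,\lambda,\mu)$ then, for $\mu>0$, $$\|x-\hat{x}\|^2 \leq \frac{4\lambda}{A_3} + \frac{2\|\nu\|}{\sqrt{A_3}} + \frac{\|\nu\|^2}{4\mu}.$$
   Context: $H$ is a finite-dimensional complex Hilbert space, with scalar product $\langle\cdot,\cdot\rangle$ linear in the first and antilinear in the second argument, and $\{f_1,\dots,f_m\}$ is a frame (spanning set) for $H$. $\alpha(x)=(|\langle x,f_k\rangle|^2)_{1\le k\le m}\in\mathbb{R}^m$. For an operator $T$ on $H$, $\mathcal{A}(T)=(\langle Tf_k,f_k\rangle)_{1\le k\le m}$; thus $\mathcal{A}(xx^* )=\alpha(x)$. For $u,v\in H$, $uv^*$ is the operator $w\mapsto\langle w,v\rangle u$ and $\llbracket u,v\rrbracket=\frac12(uv^*+vu^* )$. $\mathcal{S}^{p,q}$ is the set of self-adjoint operators on $H$ having at most $p$ strictly positive and at most $q$ strictly negative eigenvalues (counted with multiplicity). $\|\cdot\|_1$ on operators is the nuclear norm; $\|\cdot\|$ on $\mathbb{R}^m$ is the Euclidean norm. Assumption A: for every $x\in H$ there is a unique $X\in\mathcal{S}^{1,1}$ so that $\mathcal{A}(X)=\mathcal{A}(xx^* )$, namely $X=xx^*$. For $u,v\in H$, $\lambda,\mu\ge0$, $$J(u,v,\lambda,\mu)=\sum_{k=1}^m\left|y_k-\tfrac12\left(\langle u,f_k\rangle\langle f_k,v\rangle+\langle v,f_k\rangle\langle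 f_k,u\rangle\right)\right|^2+\lambda\|u\|^2+\mu\|u-v\|^2+\lambda\|v\|^2 .$$ *)

theory Defs
  imports "HOL-Analysis.Analysis"
begin

text \<open>
  The real inner product (hence norm and topology) of a complex inner product space is
  fixed to be the real part of the complex one; positive definiteness of \<open>cinner\<close> is thereby
  inherited from \<^class>\<open>real_inner\<close>.
\<close>

class complex_inner = real_inner +
  fixes scaleC :: "complex \<Rightarrow> 'a \<Rightarrow> 'a"  (infixr "*\<^sub>C" 75)
    and cinner :: "'a \<Rightarrow> 'a \<Rightarrow> complex"
  assumes scaleC_add_right: "c *\<^sub>C (x + y) = c *\<^sub>C x + c *\<^sub>C y"
    and scaleC_add_left: "(c + d) *\<^sub>C x = c *\<^sub>C x + d *\<^sub>C x"
    and scaleC_scaleC: "c *\<^sub>C d *\<^sub>C x = (c * d) *\<^sub>C x"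
    and scaleC_one: "1 *\<^sub>C x = x"
    and scaleR_scaleC: "r *\<^sub>R x = complex_of_real r *\<^sub>C x"
    and cinner_commute: "cinner x y = cnj (cinner y x)"
    and cinner_add_left: "cinner (x + y) z = cinner x z + cinner y z"
    and cinner_scaleC_left: "cinner (c *\<^sub>C x) y = c * cinner x y"
    and inner_eq_Re_cinner: "x \<bullet> y = Re (cinner x y)"

global_interpretation complex_vector: vector_space "scaleC :: complex \<Rightarrow> 'a \<Rightarrow> 'a::complex_inner"
  defines cspan = complex_vector.span and cdim = complex_vector.dim
  by standard
    (simp_all add: scaleC_add_right scaleC_add_left scaleC_scaleC scaleC_one)

abbreviation clinear :: "('a::complex_inner \<Rightarrow> 'a) \<Rightarrow> bool"
  where "clinear \<equiv> Vector_Spaces.linear scaleC scaleC"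

class fd_complex_hilbert = complex_inner +
  assumes finite_dimensional: "\<exists>B. finite B \<and> (\<forall>x. \<exists>c. x = (\<Sum>b\<in>B. c b *\<^sub>C b))"

definition cadjoint :: "('a::complex_inner \<Rightarrow> 'a) \<Rightarrow> 'a \<Rightarrow> 'a"
  where "cadjoint T = (SOME S. \<forall>x y. cinner (T x) y = cinner x (S y))"

definition self_adjoint :: "('a::complex_inner \<Rightarrow> 'a) \<Rightarrow> bool"
  where "self_adjoint T \<longleftrightarrow> clinear T \<and> (\<forall>x y. cinner (T x) y = cinner x (T y))"

definition eigenspace :: "('a::complex_inner \<Rightarrow> 'a) \<Rightarrow> complex \<Rightarrow> 'a set"
  where "eigenspace T c = {w. T w = c *\<^sub>C w}"

definition eigenvalue :: "('a::complex_inner \<Rightarrow> 'a) \<Rightarrow> complex \<Rightarrow> bool"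
  where "eigenvalue T c \<longleftrightarrow> (\<exists>w. w \<noteq> 0 \<and> T w = c *\<^sub>C w)"

text \<open>
  Eigenvalues are counted with the dimension of their eigenspace.  This is only applied to
  self-adjoint operators, for which all eigenvalues are real and geometric and algebraic
  multiplicities agree.
\<close>

definition num_pos_eigenvalues :: "('a::fd_complex_hilbert \<Rightarrow> 'a) \<Rightarrow> nat"
  where "num_pos_eigenvalues T =
    (\<Sum>r | 0 < r \<and> eigenvalue T (complex_of_real r). cdim (eigenspace T (complex_of_real r)))"

definition num_neg_eigenvalues :: "('a::fd_complex_hilbert \<Rightarrow> 'a) \<Rightarrow> nat"
  where "num_neg_eigenvalues T =
    (\<Sum>r | r < 0 \<and> eigenvalue T (complex_of_real r). cdim (eigenspace T (complex_of_real r)))"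

definition S_set :: "nat \<Rightarrow> nat \<Rightarrow> ('a::fd_complex_hilbert \<Rightarrow> 'a) set"
  where "S_set p q =
    {T. self_adjoint T \<and> num_pos_eigenvalues T \<le> p \<and> num_neg_eigenvalues T \<le> q}"

text \<open>
  The nuclear norm is the sum of the singular values: each \<open>s > 0\<close> such that \<open>s\<^sup>2\<close> is an
  eigenvalue of \<open>T\<^sup>* T\<close> contributes \<open>s\<close> once per dimension of the eigenspace.
\<close>

definition nuclear_norm :: "('a::fd_complex_hilbert \<Rightarrow> 'a) \<Rightarrow> real"
  where "nuclear_norm T =
    (\<Sum>s | 0 < s \<and> eigenvalue (cadjoint T \<circ> T) (complex_of_real (s\<^sup>2)).
       real (cdim (eigenspace (cadjoint T \<circ> T) (complex_of_real (s\<^sup>2)))) * s)"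

definition outer :: "'a::complex_inner \<Rightarrow> 'a \<Rightarrow> 'a \<Rightarrow> 'a"
  where "outer u v = (\<lambda>w. cinner w v *\<^sub>C u)"

definition sym_outer :: "'a::complex_inner \<Rightarrow> 'a \<Rightarrow> 'a \<Rightarrow> 'a"
  where "sym_outer u v = (\<lambda>w. (1/2) *\<^sub>C (outer u v w + outer v u w))"

definition alpha :: "('m::finite \<Rightarrow> 'a::complex_inner) \<Rightarrow> 'a \<Rightarrow> real ^ 'm"
  where "alpha f x = (\<chi> k. (cmod (cinner x (f k)))\<^sup>2)"

text \<open>
  The values are left complex, since \<open>\<langle>T f\<^sub>k, f\<^sub>k\<rangle>\<close> is real only for self-adjoint \<open>T\<close>; on those the
  norm of \<open>complex ^ 'm\<close> is the Euclidean norm of the corresponding real vector.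
\<close>

definition cal_A :: "('m::finite \<Rightarrow> 'a::complex_inner) \<Rightarrow> ('a \<Rightarrow> 'a) \<Rightarrow> complex ^ 'm"
  where "cal_A f T = (\<chi> k. cinner (T (f k)) (f k))"

definition is_frame :: "('m::finite \<Rightarrow> 'a::fd_complex_hilbert) \<Rightarrow> bool"
  where "is_frame f \<longleftrightarrow> cspan (range f) = UNIV"

definition assumption_A :: "('m::finite \<Rightarrow> 'a::fd_complex_hilbert) \<Rightarrow> bool"
  where "assumption_A f \<longleftrightarrow>
    (\<forall>x X. X \<in> S_set 1 1 \<and> cal_A f X = cal_A f (outer x x) \<longleftrightarrow> X = outer x x)"

definition J_obj ::
    "('m::finite \<Rightarrow> 'a::fd_complex_hilbert) \<Rightarrow> real ^ 'm \<Rightarrow> 'a \<Rightarrow> 'a \<Rightarrow> real \<Rightarrow> real \<Rightarrow> real"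
  where "J_obj f y u v lam mu =
    (\<Sum>k\<in>UNIV. (cmod (complex_of_real (y $ k)
        - 1/2 * (cinner u (f k) * cinner (f k) v + cinner v (f k) * cinner (f k) u)))\<^sup>2)
    + lam * (norm u)\<^sup>2 + mu * (norm (u - v))\<^sup>2 + lam * (norm v)\<^sup>2"

end

theory Submission
  imports Defs "HOL-Computational_Algebra.Fundamental_Theorem_Algebra"
begin

text \<open>
  Write \<open>M\<close> for the symmetrised outer product of \<open>u\<close> and \<open>v\<close>, \<open>D = M - x x\<^sup>*\<close> for the lifted error,
  \<open>d\<close> for its nuclear norm, \<open>t\<close> for the norm of its measurement vector, and \<open>n\<close> for the norm of the
  noise.

  Comparing the objective at \<open>(u, v)\<close> with that at \<open>(x, x)\<close> gives
  \<open>(t - n)\<^sup>2 + lam (\<parallel>u\<parallel>\<^sup>2 + \<parallel>v\<parallel>\<^sup>2) + mu \<parallel>u - v\<parallel>\<^sup>2 \<le> n\<^sup>2 + 2 lam \<parallel>x\<parallel>\<^sup>2\<close>.  The trace of \<open>D\<close> is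
  \<open>Re \<langle>u, v\<rangle> - \<parallel>x\<parallel>\<^sup>2\<close> and is at most \<open>d\<close> in modulus, so \<open>\<parallel>x\<parallel>\<^sup>2 - (\<parallel>u\<parallel>\<^sup>2 + \<parallel>v\<parallel>\<^sup>2) / 2 \<le> d\<close> and therefore
  \<open>t\<^sup>2 - 2 n t + mu \<parallel>u - v\<parallel>\<^sup>2 \<le> 2 lam d\<close>.  Since \<open>M\<close> has at most one positive and one negative
  eigenvalue, the lower Lipschitz bound yields \<open>\<surd>A3 d \<le> t\<close>, and the quadratic inequality then gives
  \<open>d \<le> 2 lam / A3 + 2 n / \<surd>A3\<close>, which is at most the first
  bound; the second follows because the square root is subadditive.

  The other estimates rest on one duality fact, \<open>nuclear_norm_ge_reflected_trace\<close>: pairing a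
  self-adjoint operator with the contraction \<open>1 - 2 e e\<^sup>*\<close>, where \<open>\<parallel>e\<parallel> \<le> 1\<close>, gives at most its nuclear
  norm.  Applied to \<open>D\<close> with \<open>e = 0\<close> or \<open>e = e\<^sub>1\<close> it bounds the squared distance from \<open>x\<close> to the estimate
  by \<open>d + a\<^sub>2\<close> (\<open>estimate_error_le\<close>), and with \<open>e = 0\<close> and \<open>e = e\<^sub>2\<close> it gives \<open>a\<^sub>2 \<le> d\<close>.  By polarization
  \<open>4 a\<^sub>2 \<le> \<parallel>u - v\<parallel>\<^sup>2\<close>, so the penalty with weight \<open>mu\<close> controls \<open>a\<^sub>2\<close>.  Keeping only that penalty in the
  comparison of objectives gives the bound that involves \<open>\<parallel>x\<parallel>\<close>.  For the bound without \<open>\<parallel>x\<parallel>\<close>, the inequality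
  \<open>t\<^sup>2 - 2 n t + 4 mu a\<^sub>2 \<le> 2 lam d\<close> is combined with \<open>a\<^sub>2 \<le> d\<close>: the former bounds \<open>a\<^sub>2\<close> when
  \<open>d\<close> is large, the latter when \<open>d\<close> is small (\<open>sum_bound_from_quadratic\<close>).

  Duality and the eigenvalue counts use the spectral theorem for self-adjoint operators
  (\<open>self_adjoint_eigenbasis\<close>); in an orthonormal eigenbasis both the nuclear norm and the numbers of
  positive and negative eigenvalues are read off from the diagonal.
\<close>

section \<open>Complex inner products and complex-linear maps\<close>

lemma cinner_add_right: "cinner x (y + z) = cinner x y + cinner x z"
  by (metis cinner_add_left cinner_commute complex_cnj_add)

lemma cinner_scaleC_right: "cinner x (c *\<^sub>C y) = cnj c * cinner x y"
  by (metis cinner_commute cinner_scaleC_left complex_cnj_mult)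

lemma cinner_zero_left [simp]: "cinner 0 x = 0"
  using cinner_add_left[of 0 0 x] by simp

lemma cinner_zero_right [simp]: "cinner x 0 = 0"
  using cinner_add_right[of x 0 0] by simp

lemma cinner_minus_left: "cinner (- x) y = - cinner x y"
  using cinner_add_left[of "- x" x y] by (simp add: eq_neg_iff_add_eq_0)

lemma cinner_minus_right: "cinner x (- y) = - cinner x y"
  using cinner_add_right[of x "- y" y] by (simp add: eq_neg_iff_add_eq_0)

lemma cinner_diff_left: "cinner (x - y) z = cinner x z - cinner y z"
  using cinner_add_left[of x "- y" z] by (simp add: cinner_minus_left)

lemma cinner_diff_right: "cinner x (y - z) = cinner x y - cinner x z"
  using cinner_add_right[of x y "- z"] by (simp add: cinner_minus_right)

lemma cinner_scaleR_left: "cinner (r *\<^sub>R x) y = complex_of_real r * cinner x y"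
  by (simp add: scaleR_scaleC cinner_scaleC_left)

lemma cinner_scaleR_right: "cinner x (r *\<^sub>R y) = complex_of_real r * cinner x y"
  by (simp add: scaleR_scaleC cinner_scaleC_right)

lemma cinner_sum_left: "cinner (sum g A) y = (\<Sum>i\<in>A. cinner (g i) y)"
  by (induction A rule: infinite_finite_induct) (simp_all add: cinner_add_left)

lemmas cinner_simps = cinner_add_left cinner_add_right cinner_diff_left cinner_diff_right
  cinner_minus_left cinner_minus_right cinner_scaleC_left cinner_scaleC_right
  cinner_scaleR_left cinner_scaleR_right

lemma cinner_self: "cinner x x = complex_of_real ((norm x)\<^sup>2)"
proof -
  have "Re (cinner x x) = (norm x)\<^sup>2"
    by (simp add: inner_eq_Re_cinner[symmetric] power2_norm_eq_inner)
  moreover have "Im (cinner x x) = 0"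
    using cinner_commute[of x x] by (simp add: complex_eq_iff)
  ultimately show ?thesis
    by (simp add: complex_eq_iff)
qed

lemma cinner_mult_swap: "cinner x y * cinner y x = complex_of_real ((cmod (cinner x y))\<^sup>2)"
  by (metis cinner_commute complex_norm_square)

lemma cmod_cinner_commute: "cmod (cinner x y) = cmod (cinner y x)"
  by (metis cinner_commute complex_mod_cnj)

lemma norm_diff_square: "(norm (x - y))\<^sup>2 = (norm x)\<^sup>2 + (norm y)\<^sup>2 - 2 * Re (cinner x y)"
  by (simp add: power2_norm_eq_inner inner_diff_left inner_diff_right inner_commute
      flip: inner_eq_Re_cinner)

lemma norm_scaleC: "norm (c *\<^sub>C x) = cmod c * norm x"
proof -
  have "complex_of_real ((norm (c *\<^sub>C x))\<^sup>2) = (c * cnj c) * complex_of_real ((norm x)\<^sup>2)"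
    by (simp only: cinner_self[symmetric] cinner_scaleC_left cinner_scaleC_right mult_ac)
  also have "\<dots> = complex_of_real ((cmod c * norm x)\<^sup>2)"
    by (simp only: power_mult_distrib of_real_mult complex_norm_square)
  finally have "complex_of_real ((norm (c *\<^sub>C x))\<^sup>2) = complex_of_real ((cmod c * norm x)\<^sup>2)" .
  then have "(norm (c *\<^sub>C x))\<^sup>2 = (cmod c * norm x)\<^sup>2"
    by (simp only: of_real_eq_iff)
  then show ?thesis
    by (rule power2_eq_imp_eq) simp_all
qed

text \<open>
  The component of \<open>w\<close> orthogonal to a unit vector has nonnegative squared norm.
\<close>

lemma cmod_cinner_unit_le:
  assumes "norm e = 1"
  shows "(cmod (cinner w e))\<^sup>2 \<le> (norm w)\<^sup>2"
proof -
  have "Re (cinner w (cinner w e *\<^sub>C e)) = (cmod (cinner w e))\<^sup>2"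
    by (simp add: cinner_scaleC_right cmod_power2 flip: power2_eq_square)
  then have "(norm (w - cinner w e *\<^sub>C e))\<^sup>2 = (norm w)\<^sup>2 - (cmod (cinner w e))\<^sup>2"
    by (simp add: norm_diff_square norm_scaleC assms)
  then show ?thesis
    by (metis diff_ge_0_iff_ge zero_le_power2)
qed

lemma norm_eq_1_cinner:
  assumes "cinner e e = 1"
  shows "norm e = 1"
proof -
  have "complex_of_real ((norm e)\<^sup>2) = complex_of_real 1"
    using assms by (simp add: cinner_self)
  then have "(norm e)\<^sup>2 = 1"
    by (simp only: of_real_eq_iff)
  then show ?thesis
    using norm_ge_zero[of e] by (simp add: power2_eq_1_iff)
qed

lemma clinear_iff:
  "clinear T \<longleftrightarrow> (\<forall>x y. T (x + y) = T x + T y) \<and> (\<forall>c x. T (c *\<^sub>C x) = c *\<^sub>C T x)"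
  by (simp add: Vector_Spaces.linear_iff complex_vector.vector_space_axioms)

lemma
  assumes "clinear T"
  shows clinear_add: "T (x + y) = T x + T y"
    and clinear_scaleC: "T (c *\<^sub>C x) = c *\<^sub>C T x"
    and clinear_zero: "T 0 = 0"
    and clinear_diff: "T (x - y) = T x - T y"
proof -
  show *: "T (x + y) = T x + T y" "T (c *\<^sub>C x) = c *\<^sub>C T x" for x y c
    using assms by (simp_all add: clinear_iff)
  show "T 0 = 0"
    using *(1)[of 0 0] by simp
  show "T (x - y) = T x - T y"
    using *(1)[of "x - y" y] by simp
qed

lemma clinear_sum:
  assumes "clinear T"
  shows "T (sum g A) = (\<Sum>i\<in>A. T (g i))"
  by (induction A rule: infinite_finite_induct)
    (simp_all add: clinear_add[OF assms] clinear_zero[OF assms])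

section \<open>Eigenvectors in invariant subspaces\<close>

text \<open>
  The vector \<open>p(T) v\<close>, for a complex polynomial \<open>p\<close>.
\<close>

definition poly_act :: "('a::complex_inner \<Rightarrow> 'a) \<Rightarrow> complex poly \<Rightarrow> 'a \<Rightarrow> 'a"
  where "poly_act T p v = (\<Sum>i\<le>degree p. coeff p i *\<^sub>C (T ^^ i) v)"

lemma poly_act_eq:
  assumes "degree p \<le> n"
  shows "poly_act T p v = (\<Sum>i\<le>n. coeff p i *\<^sub>C (T ^^ i) v)"
  unfolding poly_act_def
  by (rule sum.mono_neutral_left) (use assms in \<open>auto simp: coeff_eq_0\<close>)

lemma poly_act_linear_factor:
  assumes T: "clinear T"
  shows "poly_act T ([:- z, 1:] * q) v = T (poly_act T q v) - z *\<^sub>C poly_act T q v"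
proof -
  let ?n = "degree q"
  have eq: "[:- z, 1:] * q = pCons 0 q - smult z q"
    by simp
  have "degree ([:- z, 1:] * q) \<le> Suc ?n"
    by (rule order.trans[OF degree_mult_le]) simp
  then have "poly_act T ([:- z, 1:] * q) v
      = (\<Sum>i\<le>Suc ?n. (coeff (pCons 0 q) i - z * coeff q i) *\<^sub>C (T ^^ i) v)"
    unfolding eq by (subst poly_act_eq[of _ "Suc ?n"]) (simp_all del: sum.atMost_Suc)
  also have "\<dots> = (\<Sum>i\<le>Suc ?n. coeff (pCons 0 q) i *\<^sub>C (T ^^ i) v)
      - (\<Sum>i\<le>Suc ?n. z *\<^sub>C coeff q i *\<^sub>C (T ^^ i) v)"
    by (simp del: sum.atMost_Suc add: complex_vector.scale_left_diff_distrib sum_subtractf scaleC_scaleC)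
  also have "(\<Sum>i\<le>Suc ?n. coeff (pCons 0 q) i *\<^sub>C (T ^^ i) v) = T (poly_act T q v)"
    by (simp del: sum.atMost_Suc
        add: sum.atMost_Suc_shift poly_act_def clinear_sum[OF T] clinear_scaleC[OF T])
  also have "(\<Sum>i\<le>Suc ?n. z *\<^sub>C coeff q i *\<^sub>C (T ^^ i) v) = z *\<^sub>C poly_act T q v"
    by (simp only: poly_act_eq[of q "Suc ?n"] complex_vector.scale_sum_right le_SucI order_refl)
  finally show ?thesis .
qed

text \<open>
  In finite dimension a long enough initial segment of any sequence of vectors satisfies a
  nontrivial linear relation.  Repetitions in the sequence are treated separately, because linear
  dependence of a set does not see them.
\<close>

lemma family_linearly_dependent:
  fixes g :: "nat \<Rightarrow> 'a::fd_complex_hilbert"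
  shows "\<exists>n c. (\<exists>i\<le>n. c i \<noteq> 0) \<and> (\<Sum>i\<le>n. c i *\<^sub>C g i) = 0"
proof -
  obtain B :: "'a set" where B: "finite B" "\<forall>x. \<exists>c. x = (\<Sum>b\<in>B. c b *\<^sub>C b)"
    using finite_dimensional by blast
  have span: "cspan B = UNIV"
    using B by (auto simp: complex_vector.span_finite)
  let ?n = "card B"
  show ?thesis
  proof (cases "inj_on g {..?n}")
    case True
    have "complex_vector.dependent (g ` {..?n})"
    proof (rule ccontr)
      assume "complex_vector.independent (g ` {..?n})"
      then have "card (g ` {..?n}) \<le> ?n"
        using complex_vector.independent_span_bound[OF B(1)] span by blast
      then show False
        using True by (simp add: card_image)
    qed
    then obtain u where u: "\<exists>w\<in>g ` {..?n}. u w \<noteq> 0" "(\<Sum>w\<in>g ` {..?n}. u w *\<^sub>C w) = 0"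
      by (auto simp: complex_vector.dependent_finite)
    then have "(\<Sum>i\<le>?n. u (g i) *\<^sub>C g i) = 0"
      using True by (simp add: sum.reindex)
    with u(1) show ?thesis
      by (intro exI[of _ ?n] exI[of _ "u \<circ> g"]) auto
  next
    case False
    then obtain i j where ij: "i \<le> ?n" "j \<le> ?n" "i \<noteq> j" "g i = g j"
      by (auto simp: inj_on_def)
    define c where "c k = (if k = i then 1 else if k = j then - 1 else 0 :: complex)" for k
    have "(\<Sum>k\<le>?n. c k *\<^sub>C g k) = (\<Sum>k\<in>{i, j}. c k *\<^sub>C g k)"
      by (rule sum.mono_neutral_right) (use ij in \<open>auto simp: c_def\<close>)
    also have "\<dots> = 0"
      using ij by (simp add: c_def scaleC_one complex_vector.scale_minus_left)
    finally show ?thesis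
      using ij(1) by (intro exI[of _ ?n] exI[of _ c]) (auto simp: c_def)
  qed
qed

text \<open>
  The vectors \<open>v, T v, T\<^sup>2 v, \<dots>\<close> are linearly dependent, so \<open>p(T) v = 0\<close> for some nonzero
  polynomial \<open>p\<close>; take one of least degree.  It has a root \<open>z\<close> and factors as \<open>p = (X - z) q\<close>,
  where \<open>q(T) v \<noteq> 0\<close> by minimality.  This vector is an eigenvector for \<open>z\<close>, and it lies in every
  invariant subspace that contains \<open>v\<close>.
\<close>

lemma invariant_subspace_eigenvector:
  fixes T :: "'a::fd_complex_hilbert \<Rightarrow> 'a"
  assumes T: "clinear T" and W: "complex_vector.subspace W" "\<And>w. w \<in> W \<Longrightarrow> T w \<in> W"
    and v: "v \<in> W" "v \<noteq> 0"
  shows "\<exists>c w. w \<in> W \<and> w \<noteq> 0 \<and> T w = c *\<^sub>C w"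
proof -
  obtain n c where c: "\<exists>i\<le>n. c i \<noteq> 0" "(\<Sum>i\<le>n. c i *\<^sub>C (T ^^ i) v) = 0"
    using family_linearly_dependent[of "\<lambda>i. (T ^^ i) v"] by blast
  define p0 where "p0 = (\<Sum>i\<le>n. monom (c i) i)"
  have coeff: "coeff p0 k = (if k \<le> n then c k else 0)" for k
    by (simp add: p0_def coeff_sum)
  have "p0 \<noteq> 0 \<and> poly_act T p0 v = 0"
  proof
    show "p0 \<noteq> 0"
      using c(1) coeff by (metis coeff_0)
    have "degree p0 \<le> n"
      by (rule degree_le) (simp add: coeff)
    then show "poly_act T p0 v = 0"
      using c(2) by (simp add: poly_act_eq coeff)
  qed
  then obtain p where p: "p \<noteq> 0" "poly_act T p v = 0"
    and min: "\<And>q. q \<noteq> 0 \<Longrightarrow> poly_act T q v = 0 \<Longrightarrow> degree p \<le> degree q"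
    using ex_has_least_nat[of "\<lambda>p. p \<noteq> 0 \<and> poly_act T p v = 0" p0 degree] by metis
  have "degree p \<noteq> 0"
  proof
    assume "degree p = 0"
    then obtain a where "p = [:a:]"
      by (rule degree_eq_zeroE)
    then show False
      using p v by (simp add: poly_act_def complex_vector.scale_eq_0_iff)
  qed
  then obtain z where "poly p z = 0"
    using fundamental_theorem_of_algebra[of p] by (auto simp: constant_degree)
  then obtain q where q: "p = [:- z, 1:] * q"
    by (metis poly_eq_0_iff_dvd dvdE)
  have q0: "q \<noteq> 0"
    using p(1) q by auto
  then have "degree p = Suc (degree q)"
    unfolding q by (subst degree_mult_eq) auto
  then have "poly_act T q v \<noteq> 0"
    using min[of q] q0 by auto
  moreover have "poly_act T q v \<in> W"
  proof -
    have "(T ^^ i) v \<in> W" for i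
      by (induction i) (auto simp: v W)
    then show ?thesis
      unfolding poly_act_def
      by (intro complex_vector.subspace_sum complex_vector.subspace_scale W)
  qed
  moreover have "T (poly_act T q v) = z *\<^sub>C poly_act T q v"
    using p(2) poly_act_linear_factor[OF T, of z q v] unfolding q by (metis right_minus_eq)
  ultimately show ?thesis
    by blast
qed

section \<open>The spectral theorem\<close>

definition orthonormal :: "'a::complex_inner set \<Rightarrow> bool"
  where "orthonormal B \<longleftrightarrow> (\<forall>b\<in>B. \<forall>c\<in>B. cinner b c = (if b = c then 1 else 0))"

definition orthonormal_basis :: "'a::complex_inner set \<Rightarrow> bool"
  where "orthonormal_basis B \<longleftrightarrow> finite B \<and> orthonormal B \<and> cspan B = UNIV"

lemma cinner_orthonormal_sum:
  assumes "finite B" "orthonormal B" "b \<in> B"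
  shows "cinner (\<Sum>c\<in>B. g c *\<^sub>C c) b = g b"
proof -
  have "cinner (\<Sum>c\<in>B. g c *\<^sub>C c) b = (\<Sum>c\<in>B. if c = b then g c else 0)"
    unfolding cinner_sum_left cinner_scaleC_left
    by (intro sum.cong) (use assms in \<open>auto simp: orthonormal_def\<close>)
  then show ?thesis
    using assms by simp
qed

lemma orthonormal_independent:
  assumes "finite B" "orthonormal B"
  shows "complex_vector.independent B"
proof (rule complex_vector.independent_if_scalars_zero[OF assms(1)])
  fix g b
  assume "(\<Sum>c\<in>B. g c *\<^sub>C c) = 0" "b \<in> B"
  then show "g b = 0"
    using cinner_orthonormal_sum[OF assms \<open>b \<in> B\<close>, of g] by simp
qed

lemma orthonormal_basis_expansion:
  assumes "orthonormal_basis B"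
  shows "w = (\<Sum>b\<in>B. cinner w b *\<^sub>C b)"
proof -
  have B: "finite B" "orthonormal B" "cspan B = UNIV"
    using assms by (auto simp: orthonormal_basis_def)
  have "w \<in> cspan B"
    using B by simp
  then obtain g where g: "w = (\<Sum>b\<in>B. g b *\<^sub>C b)"
    using B(1) by (auto simp: complex_vector.span_finite)
  have "(\<Sum>b\<in>B. cinner w b *\<^sub>C b) = (\<Sum>b\<in>B. g b *\<^sub>C b)"
    by (rule sum.cong) (simp_all add: g cinner_orthonormal_sum[OF B(1,2)])
  then show ?thesis
    using g by simp
qed

lemma parseval:
  assumes "orthonormal_basis B"
  shows "cinner w z = (\<Sum>b\<in>B. cinner w b * cinner b z)"
proof -
  have "cinner w z = cinner (\<Sum>b\<in>B. cinner w b *\<^sub>C b) z"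
    using orthonormal_basis_expansion[OF assms, of w] by simp
  then show ?thesis
    by (simp add: cinner_sum_left cinner_scaleC_left)
qed

definition eigenbasis :: "('a::complex_inner \<Rightarrow> 'a) \<Rightarrow> 'a set \<Rightarrow> ('a \<Rightarrow> real) \<Rightarrow> bool"
  where "eigenbasis T B l \<longleftrightarrow>
    orthonormal_basis B \<and> clinear T \<and> (\<forall>b\<in>B. T b = complex_of_real (l b) *\<^sub>C b)"

lemma self_adjoint_eigenvalue_real:
  assumes "self_adjoint T" "w \<noteq> 0" "T w = c *\<^sub>C w"
  shows "c = complex_of_real (Re c)"
proof -
  have "cinner (T w) w = cinner w (T w)"
    using assms(1) by (simp add: self_adjoint_def)
  then have "c = cnj c"
    using assms(2,3) by (simp add: cinner_simps cinner_self)
  then show ?thesis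
    by (simp add: complex_eq_iff)
qed

text \<open>
  A largest orthonormal set of eigenvectors spans: its orthogonal complement is invariant because
  \<open>T\<close> is self-adjoint, so if it were nonzero it would contain a further unit eigenvector.
\<close>

theorem self_adjoint_eigenbasis:
  fixes T :: "'a::fd_complex_hilbert \<Rightarrow> 'a"
  assumes T: "self_adjoint T"
  shows "\<exists>B l. eigenbasis T B l"
proof -
  have lin: "clinear T"
    using T by (simp add: self_adjoint_def)
  obtain S :: "'a set" where S: "finite S" "\<forall>x. \<exists>c. x = (\<Sum>b\<in>S. c b *\<^sub>C b)"
    using finite_dimensional by blast
  have span: "cspan S = UNIV"
    using S by (auto simp: complex_vector.span_finite)
  define good where
    "good B \<longleftrightarrow> finite B \<and> orthonormal B \<and> (\<forall>b\<in>B. \<exists>c. T b = c *\<^sub>C b)" for B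
  have bound: "card B < Suc (card S)" if "good B" for B
    using complex_vector.independent_span_bound[OF S(1) orthonormal_independent[of B]] that span
    by (simp add: good_def)
  have "good {}"
    by (simp add: good_def orthonormal_def)
  then obtain B where B: "good B" and max: "\<And>C. good C \<Longrightarrow> card C \<le> card B"
    using ex_has_greatest_nat[of good "{}" card "Suc (card S)"] bound by (metis less_imp_le)
  have fin: "finite B" and on: "orthonormal B" and ev: "\<forall>b\<in>B. \<exists>c. T b = c *\<^sub>C b"
    using B by (auto simp: good_def)
  have "cspan B = UNIV"
  proof (rule ccontr)
    assume "cspan B \<noteq> UNIV"
    then obtain v where v: "v \<notin> cspan B"
      by blast
    define W where "W = {w. \<forall>b\<in>B. cinner w b = 0}"
    \<comment> \<open>the component of \<open>v\<close> orthogonal to the span of \<open>B\<close>\<close>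
    define v' where "v' = v - (\<Sum>b\<in>B. cinner v b *\<^sub>C b)"
    have "v' \<in> W"
      by (simp add: W_def v'_def cinner_simps cinner_orthonormal_sum[OF fin on])
    moreover have "v' \<noteq> 0"
      using v complex_vector.span_sum[of B "\<lambda>b. cinner v b *\<^sub>C b" B]
      by (auto simp: v'_def complex_vector.span_scale complex_vector.span_base)
    moreover have "complex_vector.subspace W"
      by (auto simp: complex_vector.subspace_def W_def cinner_simps)
    moreover have "T w \<in> W" if "w \<in> W" for w
    proof -
      have "cinner (T w) b = 0" if b: "b \<in> B" for b
      proof -
        obtain c where "T b = c *\<^sub>C b"
          using ev b by blast
        then show ?thesis
          using T \<open>w \<in> W\<close> b by (simp add: self_adjoint_def cinner_simps W_def)
      qed
      then show ?thesis
        by (simp add: W_def)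
    qed
    ultimately obtain c w where w: "w \<in> W" "w \<noteq> 0" "T w = c *\<^sub>C w"
      using invariant_subspace_eigenvector[OF lin] by metis
    define e where "e = inverse (norm w) *\<^sub>R w"
    have e: "cinner e e = 1"
      using w(2) by (simp add: e_def cinner_self)
    have orth: "cinner e b = 0" "cinner b e = 0" if "b \<in> B" for b
      using w(1) that cinner_commute[of b w] by (simp_all add: e_def W_def cinner_simps)
    have "e \<notin> B"
      using e orth by force
    have "T e = c *\<^sub>C e"
      by (simp add: e_def scaleR_scaleC clinear_scaleC[OF lin] w(3) scaleC_scaleC mult.commute)
    then have "good (insert e B)"
      using fin on ev e orth by (auto simp: good_def orthonormal_def)
    then show False
      using max[of "insert e B"] fin \<open>e \<notin> B\<close> by simp
  qed
  then have basis: "orthonormal_basis B"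
    using fin on by (simp add: orthonormal_basis_def)
  have "\<exists>r. T b = complex_of_real r *\<^sub>C b" if b: "b \<in> B" for b
  proof -
    obtain c where c: "T b = c *\<^sub>C b"
      using ev b by blast
    have "cinner b b = 1"
      using on b by (simp add: orthonormal_def)
    then have "b \<noteq> 0"
      by auto
    then show ?thesis
      using self_adjoint_eigenvalue_real[OF T _ c] c by metis
  qed
  then obtain l where "\<forall>b\<in>B. T b = complex_of_real (l b) *\<^sub>C b"
    by metis
  then show ?thesis
    using basis lin by (auto simp: eigenbasis_def)
qed

text \<open>
  An operator with an orthonormal basis of eigenvectors for real eigenvalues acts diagonally on
  coordinates; this is how the eigenspaces below are read off.
\<close>

lemma eigenbasis_cinner_right:
  assumes "eigenbasis T B l" "b \<in> B"
  shows "cinner (T w) b = complex_of_real (l b) * cinner w b"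
proof -
  have B: "orthonormal_basis B" "finite B" "orthonormal B" "clinear T"
    "\<forall>b\<in>B. T b = complex_of_real (l b) *\<^sub>C b"
    using assms(1) by (auto simp: eigenbasis_def orthonormal_basis_def)
  have "T w = T (\<Sum>b\<in>B. cinner w b *\<^sub>C b)"
    using orthonormal_basis_expansion[OF B(1), of w] by simp
  also have "\<dots> = (\<Sum>b\<in>B. (cinner w b * complex_of_real (l b)) *\<^sub>C b)"
    using B(5) by (simp add: clinear_sum[OF B(4)] clinear_scaleC[OF B(4)] scaleC_scaleC)
  finally show ?thesis
    using cinner_orthonormal_sum[OF B(2,3) assms(2)] by (simp add: mult.commute)
qed

lemma eigenspace_eigenbasis:
  assumes "eigenbasis T B l"
  shows "eigenspace T (complex_of_real r) = cspan {b \<in> B. l b = r}"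
proof
  have B: "orthonormal_basis B" "finite B" "clinear T"
    "\<forall>b\<in>B. T b = complex_of_real (l b) *\<^sub>C b"
    using assms by (auto simp: eigenbasis_def orthonormal_basis_def)
  show "eigenspace T (complex_of_real r) \<subseteq> cspan {b \<in> B. l b = r}"
  proof
    fix w assume "w \<in> eigenspace T (complex_of_real r)"
    then have w: "T w = complex_of_real r *\<^sub>C w"
      by (simp add: eigenspace_def)
    have "cinner w b *\<^sub>C b \<in> cspan {b \<in> B. l b = r}" if "b \<in> B" for b
    proof (cases "l b = r")
      case True
      then show ?thesis
        using that by (intro complex_vector.span_scale complex_vector.span_base) simp
    next
      case False
      then have "cinner w b = 0"
        using eigenbasis_cinner_right[OF assms that, of w] by (simp add: w cinner_simps)
      then show ?thesis
        by (simp add: complex_vector.span_zero)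
    qed
    then have "(\<Sum>b\<in>B. cinner w b *\<^sub>C b) \<in> cspan {b \<in> B. l b = r}"
      by (rule complex_vector.span_sum)
    then show "w \<in> cspan {b \<in> B. l b = r}"
      by (simp flip: orthonormal_basis_expansion[OF B(1)])
  qed
  have "complex_vector.subspace (eigenspace T (complex_of_real r))"
    by (auto simp: complex_vector.subspace_def eigenspace_def clinear_zero[OF B(3)]
        clinear_add[OF B(3)] clinear_scaleC[OF B(3)] scaleC_add_right scaleC_scaleC mult.commute)
  moreover have "{b \<in> B. l b = r} \<subseteq> eigenspace T (complex_of_real r)"
    using B(4) by (auto simp: eigenspace_def)
  ultimately show "cspan {b \<in> B. l b = r} \<subseteq> eigenspace T (complex_of_real r)"
    by (rule complex_vector.span_minimal[rotated])
qed

lemma cdim_eigenspace: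
  assumes "eigenbasis T B l"
  shows "cdim (eigenspace T (complex_of_real r)) = card {b \<in> B. l b = r}"
proof -
  have "finite {b \<in> B. l b = r}" "orthonormal {b \<in> B. l b = r}"
    using assms by (auto simp: eigenbasis_def orthonormal_basis_def orthonormal_def)
  then show ?thesis
    unfolding eigenspace_eigenbasis[OF assms]
    by (intro complex_vector.dim_span_eq_card_independent orthonormal_independent)
qed

lemma eigenvalue_eigenbasis:
  assumes "eigenbasis T B l"
  shows "eigenvalue T (complex_of_real r) \<longleftrightarrow> (\<exists>b\<in>B. l b = r)"
proof
  assume "eigenvalue T (complex_of_real r)"
  then obtain w where "w \<noteq> 0" "w \<in> cspan {b \<in> B. l b = r}"
    by (auto simp: eigenvalue_def eigenspace_def simp flip: eigenspace_eigenbasis[OF assms])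
  then show "\<exists>b\<in>B. l b = r"
    by (metis (mono_tags, lifting) Collect_empty_eq complex_vector.span_empty singletonD)
next
  assume "\<exists>b\<in>B. l b = r"
  then obtain b where b: "b \<in> B" "l b = r"
    by blast
  then have "cinner b b = 1" "T b = complex_of_real r *\<^sub>C b"
    using assms by (auto simp: eigenbasis_def orthonormal_basis_def orthonormal_def)
  then show "eigenvalue T (complex_of_real r)"
    unfolding eigenvalue_def by (metis cinner_zero_left zero_neq_one)
qed

section \<open>Counting eigenvalues and the nuclear norm in an eigenbasis\<close>

text \<open>
  The spectral quantities are sums over distinct eigenvalues weighted by multiplicities; they
  become sums over basis vectors by grouping the basis into the fibres of the eigenvalue map.
\<close>

lemma sum_over_fibres:
  fixes g :: "'b \<Rightarrow> 'c::comm_semiring_1"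
  assumes "finite B"
  shows "(\<Sum>s | P s \<and> (\<exists>b\<in>B. k b = s). of_nat (card {b \<in> B. k b = s}) * g s)
    = (\<Sum>b | b \<in> B \<and> P (k b). g (k b))"
proof -
  let ?B = "{b \<in> B. P (k b)}"
  have "(\<Sum>b\<in>?B. g (k b)) = (\<Sum>s\<in>k ` ?B. \<Sum>b | b \<in> ?B \<and> k b = s. g (k b))"
    using assms by (intro sum.image_gen) simp
  also have "\<dots> = (\<Sum>s\<in>k ` ?B. of_nat (card {b \<in> B. k b = s}) * g s)"
  proof (rule sum.cong[OF refl])
    fix s assume "s \<in> k ` ?B"
    then have "{b. b \<in> ?B \<and> k b = s} = {b \<in> B. k b = s}"
      by auto
    then show "(\<Sum>b | b \<in> ?B \<and> k b = s. g (k b)) = of_nat (card {b \<in> B. k b = s}) * g s"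
      by simp
  qed
  also have "k ` ?B = {s. P s \<and> (\<exists>b\<in>B. k b = s)}"
    by auto
  finally show ?thesis
    by simp
qed

lemma num_pos_eigenvalues_eigenbasis:
  assumes "eigenbasis T B l"
  shows "num_pos_eigenvalues T = card {b \<in> B. 0 < l b}"
  using sum_over_fibres[where B = B and P = "\<lambda>r. 0 < r" and k = l and g = "\<lambda>_. 1 :: nat"] assms
  by (simp add: num_pos_eigenvalues_def cdim_eigenspace[OF assms] eigenvalue_eigenbasis[OF assms]
      eigenbasis_def orthonormal_basis_def)

lemma num_neg_eigenvalues_eigenbasis:
  assumes "eigenbasis T B l"
  shows "num_neg_eigenvalues T = card {b \<in> B. l b < 0}"
  using sum_over_fibres[where B = B and P = "\<lambda>r. r < 0" and k = l and g = "\<lambda>_. 1 :: nat"] assms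
  by (simp add: num_neg_eigenvalues_def cdim_eigenspace[OF assms] eigenvalue_eigenbasis[OF assms]
      eigenbasis_def orthonormal_basis_def)

lemma cadjoint_self_adjoint:
  assumes "self_adjoint T"
  shows "cadjoint T = T"
  unfolding cadjoint_def
proof (rule some_equality)
  show T: "\<forall>x y. cinner (T x) y = cinner x (T y)"
    using assms by (simp add: self_adjoint_def)
  fix S assume S: "\<forall>x y. cinner (T x) y = cinner x (S y)"
  have "cinner (S y - T y) (S y - T y) = 0" for y
    using S T by (metis cinner_diff_right right_minus_eq)
  then show "S = T"
    by (simp add: fun_eq_iff cinner_self)
qed

text \<open>
  The operator \<open>T\<^sup>* T = T\<^sup>2\<close> has the eigenvalues \<open>(l b)\<^sup>2\<close> in the same basis, so the singular values
  of a self-adjoint \<open>T\<close> are the numbers \<open>\<bar>l b\<bar>\<close>.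
\<close>

lemma nuclear_norm_eigenbasis:
  assumes "self_adjoint T" "eigenbasis T B l"
  shows "nuclear_norm T = (\<Sum>b\<in>B. \<bar>l b\<bar>)"
proof -
  have fin: "finite B"
    using assms(2) by (simp add: eigenbasis_def orthonormal_basis_def)
  have TT: "eigenbasis (T \<circ> T) B (\<lambda>b. (l b)\<^sup>2)"
    using assms(2)
    by (auto simp: eigenbasis_def clinear_iff scaleC_scaleC power2_eq_square)
  have sq: "(l b)\<^sup>2 = s\<^sup>2 \<longleftrightarrow> \<bar>l b\<bar> = s" if "0 < s" for b s
    using that by (auto simp: power2_eq_iff)
  have "nuclear_norm T
      = (\<Sum>s | 0 < s \<and> (\<exists>b\<in>B. (l b)\<^sup>2 = s\<^sup>2). of_nat (card {b \<in> B. (l b)\<^sup>2 = s\<^sup>2}) * s)"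
    by (simp only: nuclear_norm_def cadjoint_self_adjoint[OF assms(1)] cdim_eigenspace[OF TT]
        eigenvalue_eigenbasis[OF TT])
  also have "\<dots> = (\<Sum>s | 0 < s \<and> (\<exists>b\<in>B. \<bar>l b\<bar> = s). of_nat (card {b \<in> B. \<bar>l b\<bar> = s}) * s)"
    by (rule sum.cong) (auto simp: sq cong: conj_cong)
  also have "\<dots> = (\<Sum>b | b \<in> B \<and> 0 < \<bar>l b\<bar>. \<bar>l b\<bar>)"
    by (rule sum_over_fibres[OF fin])
  also have "\<dots> = (\<Sum>b\<in>B. \<bar>l b\<bar>)"
    by (rule sum.mono_neutral_left) (use fin in auto)
  finally show ?thesis .
qed

section \<open>Trace lower bounds for the nuclear norm\<close>

text \<open>
  The real part of the trace, computed in a given orthonormal basis.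
\<close>

definition basis_trace :: "'a::complex_inner set \<Rightarrow> ('a \<Rightarrow> 'a) \<Rightarrow> real"
  where "basis_trace B T = (\<Sum>b\<in>B. Re (cinner (T b) b))"

lemma basis_trace_outer:
  assumes "orthonormal_basis B"
  shows "basis_trace B (outer u v) = Re (cinner u v)"
  unfolding basis_trace_def outer_def
  by (subst parseval[OF assms, of u v]) (simp add: cinner_simps mult.commute[of "cinner u _"])

lemma basis_trace_sym_outer:
  assumes "orthonormal_basis B"
  shows "basis_trace B (sym_outer u v) = Re (cinner u v)"
proof -
  have "basis_trace B (sym_outer u v) = (basis_trace B (outer u v) + basis_trace B (outer v u)) / 2"
    by (simp add: basis_trace_def sym_outer_def cinner_simps sum.distrib sum_divide_distrib
        add_divide_distrib flip: sum_divide_distrib)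
  also have "\<dots> = Re (cinner u v)"
    using cinner_commute[of v u] by (simp add: basis_trace_outer[OF assms])
  finally show ?thesis .
qed

text \<open>
  The left-hand side is the trace of \<open>T\<close> against \<open>Q = 1 - 2 e e\<^sup>*\<close>.  This \<open>Q\<close> is a contraction, so its
  diagonal entries \<open>1 - 2 \<bar>\<langle>e, b\<rangle>\<bar>\<^sup>2\<close> in an eigenbasis of \<open>T\<close> lie in \<open>[-1, 1]\<close>, and pairing them with the
  eigenvalues gives at most the sum of the moduli of the eigenvalues.  The case \<open>e = 0\<close> is the plain
  trace bound, the case of a unit vector \<open>e\<close> that of a reflection.  The basis does not depend
  on \<open>e\<close>.
\<close>

lemma nuclear_norm_ge_reflected_trace:
  fixes T :: "'a::fd_complex_hilbert \<Rightarrow> 'a"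
  assumes T: "self_adjoint T"
  shows "\<exists>B. orthonormal_basis B \<and>
    (\<forall>e. norm e \<le> 1 \<longrightarrow> \<bar>basis_trace B T - 2 * Re (cinner (T e) e)\<bar> \<le> nuclear_norm T)"
proof -
  obtain B l where Bl: "eigenbasis T B l"
    using self_adjoint_eigenbasis[OF T] by blast
  have B: "orthonormal_basis B"
    using Bl by (simp add: eigenbasis_def)
  have "\<bar>basis_trace B T - 2 * Re (cinner (T e) e)\<bar> \<le> nuclear_norm T" if e: "norm e \<le> 1" for e
  proof -
    have "cinner (T b) b = complex_of_real (l b)" if "b \<in> B" for b
      using Bl that by (simp add: eigenbasis_def orthonormal_basis_def orthonormal_def cinner_simps)
    then have tr: "basis_trace B T = (\<Sum>b\<in>B. l b)"
      by (simp add: basis_trace_def)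
    have "cinner (T e) e = (\<Sum>b\<in>B. complex_of_real (l b) * (cinner e b * cinner b e))"
      unfolding parseval[OF B, of "T e" e]
      by (rule sum.cong) (simp_all add: eigenbasis_cinner_right[OF Bl])
    then have "Re (cinner (T e) e) = (\<Sum>b\<in>B. l b * (cmod (cinner e b))\<^sup>2)"
      by (simp only: cinner_mult_swap flip: of_real_mult of_real_sum) simp
    then have "basis_trace B T - 2 * Re (cinner (T e) e)
        = (\<Sum>b\<in>B. l b * (1 - 2 * (cmod (cinner e b))\<^sup>2))"
      by (simp add: tr sum_distrib_left algebra_simps sum_subtractf)
    also have "\<bar>\<dots>\<bar> \<le> (\<Sum>b\<in>B. \<bar>l b\<bar>)"
    proof (rule sum_abs[THEN order.trans], rule sum_mono)
      fix b assume "b \<in> B"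
      then have "cinner b b = 1"
        using B by (simp add: orthonormal_basis_def orthonormal_def)
      then have "(cmod (cinner e b))\<^sup>2 \<le> (norm e)\<^sup>2"
        by (intro cmod_cinner_unit_le norm_eq_1_cinner)
      also have "\<dots> \<le> 1"
        using e by (simp add: power_le_one)
      finally have "\<bar>1 - 2 * (cmod (cinner e b))\<^sup>2\<bar> \<le> 1"
        by (simp add: abs_le_iff)
      then show "\<bar>l b * (1 - 2 * (cmod (cinner e b))\<^sup>2)\<bar> \<le> \<bar>l b\<bar>"
        by (simp add: abs_mult mult_left_le)
    qed
    finally show ?thesis
      by (simp add: nuclear_norm_eigenbasis[OF T Bl])
  qed
  with B show ?thesis
    by blast
qed

section \<open>Inertia of symmetrised outer products\<close>

lemma self_adjoint_sym_outer: "self_adjoint (sym_outer u v)"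
proof -
  have "clinear (sym_outer u v)"
    by (simp add: clinear_iff sym_outer_def outer_def cinner_simps scaleC_add_left scaleC_add_right
        scaleC_scaleC add_divide_distrib add_ac)
  moreover have "cinner (sym_outer u v x) y = cinner x (sym_outer u v y)" for x y
  proof -
    have "cnj (cinner y u) = cinner u y" "cnj (cinner y v) = cinner v y"
      by (metis cinner_commute)+
    then show ?thesis
      by (simp add: sym_outer_def outer_def cinner_simps algebra_simps)
  qed
  ultimately show ?thesis
    by (simp add: self_adjoint_def)
qed

lemma sym_outer_self: "sym_outer x x = outer x x"
  by (simp add: sym_outer_def outer_def fun_eq_iff scaleC_scaleC flip: scaleC_add_left)

lemma self_adjoint_diff:
  assumes "self_adjoint S" "self_adjoint T"
  shows "self_adjoint (\<lambda>w. S w - T w)"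
  using assms by (auto simp: self_adjoint_def clinear_iff cinner_simps
      complex_vector.scale_right_diff_distrib)

text \<open>
  Polarization: the symmetrised outer product of \<open>u\<close> and \<open>v\<close> is one quarter of the difference of the
  rank-one squares of \<open>u + v\<close> and \<open>u - v\<close>.  This exhibits at most one positive and at most one negative
  direction.
\<close>

lemma cinner_sym_outer:
  "cinner (sym_outer u v w) w = complex_of_real (((cmod (cinner w (u + v)))\<^sup>2 - (cmod (cinner w (u - v)))\<^sup>2) / 4)"
proof -
  have "complex_of_real (((cmod (cinner w (u + v)))\<^sup>2 - (cmod (cinner w (u - v)))\<^sup>2) / 4)
    = (cinner w (u + v) * cinner (u + v) w - cinner w (u - v) * cinner (u - v) w) / 4"
    by (simp add: cinner_mult_swap)
  also have "\<dots> = cinner (sym_outer u v w) w"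
    by (simp add: sym_outer_def outer_def cinner_simps field_simps)
  finally show ?thesis
    by simp
qed

text \<open>
  Two orthogonal eigenvectors with positive eigenvalues span a plane on which the quadratic form is
  positive definite, and this plane meets the hyperplane orthogonal to \<open>p\<close> in a nonzero vector.
\<close>

lemma num_pos_eigenvalues_le_1:
  fixes T :: "'a::fd_complex_hilbert \<Rightarrow> 'a"
  assumes T: "self_adjoint T" and p: "\<And>w. cinner w p = 0 \<Longrightarrow> Re (cinner (T w) w) \<le> 0"
  shows "num_pos_eigenvalues T \<le> 1"
proof -
  obtain B l where Bl: "eigenbasis T B l"
    using self_adjoint_eigenbasis[OF T] by blast
  have on: "finite B" "\<And>b c. b \<in> B \<Longrightarrow> c \<in> B \<Longrightarrow> cinner b c = (if b = c then 1 else 0)"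
    and ev: "\<And>b. b \<in> B \<Longrightarrow> T b = complex_of_real (l b) *\<^sub>C b" and lin: "clinear T"
    using Bl by (auto simp: eigenbasis_def orthonormal_basis_def orthonormal_def)
  have "b = c" if bc: "b \<in> B" "0 < l b" "c \<in> B" "0 < l c" for b c
  proof (rule ccontr)
    assume "b \<noteq> c"
    show False
    proof (cases "cinner b p = 0")
      case True
      then show False
        using p[OF True] bc by (simp add: ev cinner_simps on)
    next
      case False
      \<comment> \<open>the combination of \<open>b\<close> and \<open>c\<close> orthogonal to \<open>p\<close>\<close>
      define w where "w = cinner c p *\<^sub>C b - cinner b p *\<^sub>C c"
      have "cinner w p = 0"
        by (simp add: w_def cinner_simps)
      moreover have "cinner (T w) w = complex_of_real (l b * (cmod (cinner c p))\<^sup>2 + l c * (cmod (cinner b p))\<^sup>2)"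
        using bc \<open>b \<noteq> c\<close>
        by (simp add: w_def clinear_diff[OF lin] clinear_scaleC[OF lin] ev cinner_simps on
            complex_norm_square del: of_real_power)
      ultimately have "l b * (cmod (cinner c p))\<^sup>2 + l c * (cmod (cinner b p))\<^sup>2 \<le> 0"
        using p[of w] by simp
      moreover have "0 < l c * (cmod (cinner b p))\<^sup>2" "0 \<le> l b * (cmod (cinner c p))\<^sup>2"
        using bc False by simp_all
      ultimately show False
        by linarith
    qed
  qed
  then show ?thesis
    using on(1) by (simp add: num_pos_eigenvalues_eigenbasis[OF Bl] card_le_Suc0_iff_eq)
qed

lemma num_neg_eigenvalues_uminus:
  fixes T :: "'a::fd_complex_hilbert \<Rightarrow> 'a"
  assumes T: "self_adjoint T"
  shows "num_neg_eigenvalues T = num_pos_eigenvalues (\<lambda>w. - T w)"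
proof -
  obtain B l where Bl: "eigenbasis T B l"
    using self_adjoint_eigenbasis[OF T] by blast
  then have "eigenbasis (\<lambda>w. - T w) B (\<lambda>b. - l b)"
    by (auto simp: eigenbasis_def clinear_iff)
  then show ?thesis
    by (simp add: num_neg_eigenvalues_eigenbasis[OF Bl] num_pos_eigenvalues_eigenbasis)
qed

text \<open>
  The quadratic form is nonpositive on the hyperplane orthogonal to \<open>u + v\<close>.  The bound on negative
  eigenvalues follows by negating \<open>u\<close>.
\<close>

lemma sym_outer_in_S_set:
  fixes u v :: "'a::fd_complex_hilbert"
  shows "sym_outer u v \<in> S_set 1 1"
proof -
  have pos: "num_pos_eigenvalues (sym_outer u v) \<le> 1" for u v :: 'a
    by (rule num_pos_eigenvalues_le_1[OF self_adjoint_sym_outer, of "u + v"])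
      (simp add: cinner_sym_outer)
  have "(\<lambda>w. - sym_outer u v w) = sym_outer (- u) v"
    by (simp add: fun_eq_iff sym_outer_def outer_def cinner_simps)
      (simp flip: complex_vector.scale_minus_right)
  then have "num_neg_eigenvalues (sym_outer u v) \<le> 1"
    using pos[of "- u" v] by (simp add: num_neg_eigenvalues_uminus[OF self_adjoint_sym_outer])
  then show ?thesis
    using pos by (simp add: S_set_def self_adjoint_sym_outer)
qed

lemma outer_in_S_set:
  fixes x :: "'a::fd_complex_hilbert"
  shows "outer x x \<in> S_set 1 0"
proof -
  have sa: "self_adjoint (outer x x)"
    using self_adjoint_sym_outer[of x x] by (simp add: sym_outer_self)
  obtain B l where Bl: "eigenbasis (outer x x) B l"
    using self_adjoint_eigenbasis[OF sa] by blast
  have "0 \<le> l b" if b: "b \<in> B" for b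
  proof -
    have "cinner b b = 1" "outer x x b = complex_of_real (l b) *\<^sub>C b"
      using Bl b by (auto simp: eigenbasis_def orthonormal_basis_def orthonormal_def)
    then have "complex_of_real (l b) = cinner (outer x x b) b"
      by (simp add: cinner_simps)
    also have "\<dots> = complex_of_real ((cmod (cinner b x))\<^sup>2)"
      by (simp add: outer_def cinner_simps cinner_mult_swap)
    finally show ?thesis
      by (metis of_real_eq_iff zero_le_power2)
  qed
  then have "{b \<in> B. l b < 0} = {}"
    by force
  then have "num_neg_eigenvalues (outer x x) = 0"
    unfolding num_neg_eigenvalues_eigenbasis[OF Bl] by (simp only: card.empty)
  moreover have "num_pos_eigenvalues (outer x x) \<le> 1"
    using sym_outer_in_S_set[of x x] by (simp add: S_set_def sym_outer_self)
  ultimately show ?thesis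
    by (simp add: S_set_def sa)
qed

section \<open>The lifted estimation error\<close>

lemma cinner_outer_self: "cinner (outer x x w) w = complex_of_real ((cmod (cinner w x))\<^sup>2)"
  by (simp add: outer_def cinner_scaleC_left cinner_mult_swap)

text \<open>
  All estimates of the lifted error from below are instances of this one: \<open>e = 0\<close> compares traces,
  \<open>e = e\<^sub>1\<close> compares the leading eigenvector with \<open>x\<close>, and \<open>e = e\<^sub>2\<close> controls the negative eigenvalue.
\<close>

lemma nuclear_norm_lift_error_ge:
  fixes u v x :: "'a::fd_complex_hilbert"
  assumes "norm e \<le> 1"
  shows "\<bar>Re (cinner u v) - (norm x)\<^sup>2
      - 2 * (Re (cinner (sym_outer u v e) e) - (cmod (cinner e x))\<^sup>2)\<bar>
    \<le> nuclear_norm (\<lambda>w. sym_outer u v w - outer x x w)"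
proof -
  let ?D = "\<lambda>w. sym_outer u v w - outer x x w"
  have "self_adjoint ?D"
    using self_adjoint_diff[OF self_adjoint_sym_outer self_adjoint_sym_outer, of u v x x]
    by (simp add: sym_outer_self)
  then obtain B where B: "orthonormal_basis B"
    and le: "\<bar>basis_trace B ?D - 2 * Re (cinner (?D e) e)\<bar> \<le> nuclear_norm ?D"
    using nuclear_norm_ge_reflected_trace assms by blast
  have "basis_trace B ?D = basis_trace B (sym_outer u v) - basis_trace B (outer x x)"
    by (simp add: basis_trace_def cinner_diff_left sum_subtractf)
  then have "basis_trace B ?D = Re (cinner u v) - (norm x)\<^sup>2"
    by (simp add: basis_trace_sym_outer[OF B] basis_trace_outer[OF B] cinner_self)
  then show ?thesis
    using le by (simp add: cinner_diff_left cinner_outer_self)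
qed

text \<open>
  The vectors are parameters because \<open>u\<close> and \<open>v\<close> do not determine them: when \<open>a\<^sub>1\<close> or \<open>a\<^sub>2\<close> is zero, the
  corresponding vector can be any unit vector of the kernel orthogonal to the other one.
\<close>

locale rank_two_decomposition =
  fixes u v e1 e2 :: "'a::fd_complex_hilbert" and a1 a2 :: real
  assumes a1: "0 \<le> a1" and a2: "0 \<le> a2"
    and e1: "cinner e1 e1 = 1" and e2: "cinner e2 e2 = 1" and e12: "cinner e1 e2 = 0"
    and decomposition: "sym_outer u v = (\<lambda>w. a1 *\<^sub>R outer e1 e1 w - a2 *\<^sub>R outer e2 e2 w)"
begin

lemma e21: "cinner e2 e1 = 0"
  using cinner_commute[of e2 e1] e12 by simp

lemma trace: "Re (cinner u v) = a1 - a2"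
proof -
  obtain B l where "eigenbasis (sym_outer u v) B l"
    using self_adjoint_eigenbasis[OF self_adjoint_sym_outer] by blast
  then have B: "orthonormal_basis B"
    by (simp add: eigenbasis_def)
  have "basis_trace B (sym_outer u v) = a1 * basis_trace B (outer e1 e1) - a2 * basis_trace B (outer e2 e2)"
    unfolding decomposition
    by (simp add: basis_trace_def cinner_simps sum_subtractf sum_distrib_left)
  then show ?thesis
    by (simp add: basis_trace_sym_outer[OF B] basis_trace_outer[OF B] e1 e2)
qed

lemma quadratic_form:
  "Re (cinner (sym_outer u v e1) e1) = a1" "Re (cinner (sym_outer u v e2) e2) = - a2"
  by (simp_all add: decomposition outer_def cinner_simps e1 e2 e12 e21)

text \<open>
  The quadratic form at \<open>e\<^sub>2\<close> is \<open>- a\<^sub>2\<close>, and by polarization its only negative contribution comes from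
  \<open>u - v\<close>.
\<close>

lemma negative_part_le_distance: "a2 \<le> (norm (u - v))\<^sup>2 / 4"
proof -
  have "- a2 = ((cmod (cinner e2 (u + v)))\<^sup>2 - (cmod (cinner e2 (u - v)))\<^sup>2) / 4"
    using quadratic_form(2) by (simp add: cinner_sym_outer)
  moreover have "(cmod (cinner e2 (u - v)))\<^sup>2 \<le> (norm (u - v))\<^sup>2"
    using cmod_cinner_unit_le[OF norm_eq_1_cinner[OF e2], of "u - v"]
    by (simp add: cmod_cinner_commute)
  ultimately show ?thesis
    using zero_le_power2[of "cmod (cinner e2 (u + v))"] by argo
qed

text \<open>
  Add the lower bounds obtained from \<open>e = 0\<close> and from the reflection along \<open>e\<^sub>2\<close>: the terms in
  \<open>a\<^sub>1\<close> and \<open>\<parallel>x\<parallel>\<^sup>2\<close> cancel and at least \<open>2 a\<^sub>2\<close> remains.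
\<close>

lemma negative_part_le_nuclear_norm:
  "a2 \<le> nuclear_norm (\<lambda>w. sym_outer u v w - outer x x w)"
proof -
  let ?d = "nuclear_norm (\<lambda>w. sym_outer u v w - outer x x w)"
  have "(norm x)\<^sup>2 - (a1 - a2) \<le> ?d"
    using nuclear_norm_lift_error_ge[of 0 u v x] by (simp add: trace abs_le_iff)
  moreover have "a1 + a2 + 2 * (cmod (cinner e2 x))\<^sup>2 - (norm x)\<^sup>2 \<le> ?d"
    using nuclear_norm_lift_error_ge[of e2 u v x] norm_eq_1_cinner[OF e2]
    by (simp add: trace quadratic_form abs_le_iff)
  ultimately show ?thesis
    using zero_le_power2[of "cmod (cinner e2 x)"] by linarith
qed

text \<open>
  The phase aligns the estimate with \<open>x\<close>, so the squared error is
  \<open>\<parallel>x\<parallel>\<^sup>2 + a\<^sub>1 - 2 \<surd>a\<^sub>1 c\<close> with \<open>c = \<bar>\<langle>x, e\<^sub>1\<rangle>\<bar>\<close>.  If \<open>c\<close> is at least \<open>\<surd>a\<^sub>1\<close> this is at most the trace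
  difference \<open>\<parallel>x\<parallel>\<^sup>2 - a\<^sub>1\<close>; otherwise it is at most \<open>\<parallel>x\<parallel>\<^sup>2 + a\<^sub>1 - 2 c\<^sup>2\<close>, which is what the reflection along
  \<open>e\<^sub>1\<close> detects.
\<close>

lemma estimate_error_le:
  assumes phase: "cis \<phi> = cinner x e1 / complex_of_real (cmod (cinner x e1))"
  shows "(norm (x - (cis \<phi> * complex_of_real (sqrt a1)) *\<^sub>C e1))\<^sup>2
    \<le> nuclear_norm (\<lambda>w. sym_outer u v w - outer x x w) + a2"
proof -
  let ?z = "(cis \<phi> * complex_of_real (sqrt a1)) *\<^sub>C e1"
  let ?c = "cmod (cinner x e1)"
  let ?d = "nuclear_norm (\<lambda>w. sym_outer u v w - outer x x w)"
  have norm_e1: "norm e1 = 1"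
    by (rule norm_eq_1_cinner[OF e1])
  \<comment> \<open>a quotient with zero denominator is \<open>0\<close>, which is not a phase\<close>
  have "?c \<noteq> 0"
    using phase by (metis cis_neq_zero div_by_0 of_real_0)
  then have "cinner x e1 = cis \<phi> * complex_of_real ?c"
    unfolding phase by simp
  then have "cinner x ?z = (cnj (cis \<phi>) * cis \<phi>) * complex_of_real (sqrt a1 * ?c)"
    by (simp add: cinner_scaleC_right mult_ac)
  also have "cnj (cis \<phi>) * cis \<phi> = 1"
    by (simp add: cis_cnj cis_mult)
  finally have "Re (cinner x ?z) = sqrt a1 * ?c"
    by simp
  moreover have "(norm ?z)\<^sup>2 = a1"
    using a1 by (simp add: norm_scaleC norm_mult norm_e1)
  ultimately have err: "(norm (x - ?z))\<^sup>2 = (norm x)\<^sup>2 + a1 - 2 * (sqrt a1 * ?c)"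
    by (simp add: norm_diff_square)
  show ?thesis
  proof (cases "sqrt a1 \<le> ?c")
    case True
    have "a1 \<le> sqrt a1 * ?c"
      using mult_left_mono[OF True real_sqrt_ge_zero[OF a1]] a1 by simp
    moreover have "(norm x)\<^sup>2 - a1 + a2 \<le> ?d"
      using nuclear_norm_lift_error_ge[of 0 u v x] by (simp add: trace abs_le_iff)
    ultimately show ?thesis
      using err a2 by linarith
  next
    case False
    then have "?c\<^sup>2 \<le> sqrt a1 * ?c"
      by (simp add: power2_eq_square mult_right_mono)
    moreover have "(norm x)\<^sup>2 + a1 + a2 - 2 * ?c\<^sup>2 \<le> ?d"
      using nuclear_norm_lift_error_ge[of e1 u v x] norm_e1
      by (simp add: trace quadratic_form abs_le_iff cmod_cinner_commute[of e1 x])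
    ultimately show ?thesis
      using err a2 by linarith
  qed
qed

end

lemma J_obj_eq:
  "J_obj f y u v lam mu = (norm ((\<chi> k. complex_of_real (y $ k)) - cal_A f (sym_outer u v)))\<^sup>2
    + lam * (norm u)\<^sup>2 + mu * (norm (u - v))\<^sup>2 + lam * (norm v)\<^sup>2"
proof -
  have "(norm ((\<chi> k. complex_of_real (y $ k)) - cal_A f (sym_outer u v)))\<^sup>2
      = (\<Sum>k\<in>UNIV. (cmod (complex_of_real (y $ k) - cal_A f (sym_outer u v) $ k))\<^sup>2)"
    by (simp add: norm_vec_def L2_set_def sum_nonneg)
  moreover have "cal_A f (sym_outer u v) $ k
      = 1/2 * (cinner u (f k) * cinner (f k) v + cinner v (f k) * cinner (f k) u)" for k
    by (simp add: cal_A_def sym_outer_def outer_def cinner_simps mult.commute)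
  ultimately show ?thesis
    by (simp only: J_obj_def)
qed

lemma norm_of_real_vec: "norm (\<chi> k. complex_of_real (y $ k)) = norm (y :: real ^ 'm::finite)"
  by (simp add: norm_vec_def)

lemma of_real_alpha: "(\<chi> k. complex_of_real (alpha f x $ k)) = cal_A f (outer x x)"
  by (simp add: vec_eq_iff alpha_def cal_A_def cinner_outer_self cmod_cinner_commute)

text \<open>
  The residual of \<open>(u, v)\<close> is the noise minus the measured lifted error, so its norm is at least
  \<open>\<bar>t - \<parallel>\<nu>\<parallel>\<bar>\<close>; the residual of \<open>(x, x)\<close> is the noise itself.
\<close>

lemma objective_comparison:
  fixes f :: "'m::finite \<Rightarrow> 'a::fd_complex_hilbert"
  assumes y: "y = alpha f x + \<nu>" and lam: "0 \<le> lam"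
    and J: "J_obj f y u v lam mu \<le> J_obj f y x x lam mu"
  defines "t \<equiv> norm (cal_A f (sym_outer u v) - cal_A f (outer x x))"
  shows "(t - norm \<nu>)\<^sup>2 + lam * ((norm u)\<^sup>2 + (norm v)\<^sup>2) + mu * (norm (u - v))\<^sup>2
    \<le> (norm \<nu>)\<^sup>2 + 2 * lam * (norm x)\<^sup>2"
proof -
  let ?\<nu> = "\<chi> k. complex_of_real (\<nu> $ k)"
  let ?y = "\<chi> k. complex_of_real (y $ k)"
  have y': "?y = cal_A f (outer x x) + ?\<nu>"
    unfolding y of_real_alpha[symmetric] by (simp add: vec_eq_iff)
  have "\<bar>norm \<nu> - t\<bar> \<le> norm (?y - cal_A f (sym_outer u v))"
    unfolding y' t_def norm_of_real_vec[symmetric, of \<nu>]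
    by (rule order.trans[OF norm_triangle_ineq3]) (simp add: algebra_simps)
  then have "(t - norm \<nu>)\<^sup>2 \<le> (norm (?y - cal_A f (sym_outer u v)))\<^sup>2"
    by (simp add: abs_le_square_iff[symmetric] abs_minus_commute)
  moreover have "(norm (?y - cal_A f (sym_outer x x)))\<^sup>2 = (norm \<nu>)\<^sup>2"
    unfolding y' by (simp add: sym_outer_self norm_of_real_vec)
  ultimately show ?thesis
    using J by (simp add: J_obj_eq algebra_simps)
qed

section \<open>Scalar consequences\<close>

lemma linear_bound_from_quadratic:
  fixes s d t n lam :: real
  assumes s: "0 < s" and d: "s * d \<le> t" and "0 \<le> t" and n: "0 \<le> n" and lam: "0 \<le> lam"
    and q: "t\<^sup>2 - 2 * n * t \<le> 2 * lam * d"
  shows "d \<le> 2 * lam / s\<^sup>2 + 2 * n / s"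
proof -
  have dt: "d \<le> t / s"
    using s d by (simp add: pos_le_divide_eq mult.commute)
  have "t \<le> 2 * n + 2 * lam / s"
  proof (cases "t = 0")
    case True
    then show ?thesis
      using s n lam by simp
  next
    case False
    have "2 * lam * d \<le> 2 * lam * (t / s)"
      using dt lam by (intro mult_left_mono) simp_all
    then have "t * t \<le> t * (2 * n + 2 * lam / s)"
      using q by (simp add: power2_eq_square algebra_simps)
    then show ?thesis
      using False \<open>0 \<le> t\<close> by simp
  qed
  then have "t / s \<le> (2 * n + 2 * lam / s) / s"
    using s by (intro divide_right_mono) simp_all
  then show ?thesis
    using dt by (simp add: add_divide_distrib power2_eq_square)
qed

text \<open>
  The quadratic inequality bounds \<open>a\<close> for large \<open>d\<close>, while \<open>a \<le> d\<close> bounds it for small \<open>d\<close>.  Past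
  \<open>d = n\<close>, put \<open>r = 2 lam + 2 n - d\<close>, so that \<open>m a \<le> d r\<close>.  If the claim failed, then \<open>a \<le> d\<close> and the
  inequality \<open>2 m n \<le> m\<^sup>2 + n\<^sup>2\<close> would force \<open>r < m\<close>, whereas \<open>m a \<le> d r\<close> would force
  \<open>2 lam (m - r) + m r + (n - r)\<^sup>2 < 0\<close>.
\<close>

lemma sum_bound_from_quadratic_normalised:
  fixes d a t n lam m :: real
  assumes m: "0 < m" and n: "0 \<le> n" and lam: "0 \<le> lam" and d: "0 \<le> d" "d \<le> t" and a: "0 \<le> a" "a \<le> d"
    and q: "t\<^sup>2 - 2 * n * t + m * a \<le> 2 * lam * d"
  shows "d + a \<le> 4 * lam + 2 * n + n\<^sup>2 / m"
proof (cases "d \<le> n")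
  case True
  then show ?thesis
    using a m lam by (smt (verit) divide_nonneg_pos zero_le_power2)
next
  case False
  have "(d - n)\<^sup>2 \<le> (t - n)\<^sup>2"
    using False d by (intro power_mono) simp_all
  then have ma: "m * a \<le> d * (2 * lam + 2 * n - d)"
    using q by (simp add: power2_eq_square algebra_simps)
  define r where "r = 2 * lam + 2 * n - d"
  show ?thesis
  proof (rule ccontr)
    assume neg: "\<not> ?thesis"
    then have "n\<^sup>2 / m < 2 * d - 4 * lam - 2 * n"
      using a by linarith
    then have "n\<^sup>2 / m < 2 * (n - r)"
      by (simp add: r_def)
    then have 1: "n\<^sup>2 < 2 * m * (n - r)"
      using m by (simp add: pos_divide_less_eq mult_ac)
    have "r < m"
    proof -
      have "2 * m * n \<le> m\<^sup>2 + n\<^sup>2"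
        by (metis sum_squares_bound)
      then have "m * (2 * r) < m * m"
        using 1 by (simp add: power2_eq_square algebra_simps)
      then have "2 * r < m"
        using m by simp
      then show ?thesis
        using m by linarith
    qed
    have "n\<^sup>2 / m < d + a - 4 * lam - 2 * n"
      using neg by linarith
    then have "n\<^sup>2 < m * (d + a - 4 * lam - 2 * n)"
      using m by (simp add: pos_divide_less_eq mult.commute)
    also have "\<dots> = m * a - m * (2 * lam + r)"
      by (simp add: r_def algebra_simps)
    also have "\<dots> \<le> (2 * lam + 2 * n - r) * r - m * (2 * lam + r)"
      using ma by (simp add: r_def)
    finally have "2 * lam * (m - r) + m * r + (n - r)\<^sup>2 < 0"
      by (simp add: power2_eq_square algebra_simps)
    moreover have "0 \<le> r"
      using ma a(1) m d False n by (smt (verit) mult_nonneg_nonneg mult_pos_neg r_def)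
    ultimately show False
      using \<open>r < m\<close> lam m by (smt (verit) mult_nonneg_nonneg zero_le_power2)
  qed
qed

text \<open>
  Replacing \<open>d\<close>, \<open>a\<close>, \<open>lam\<close> and \<open>m\<close> by \<open>s d\<close>, \<open>s a\<close>, \<open>lam / s\<close> and \<open>4 mu / s\<close> reduces to the case \<open>s = 1\<close>.
\<close>

lemma sum_bound_from_quadratic:
  fixes s d a t n lam mu :: real
  assumes s: "0 < s" and mu: "0 < mu" and n: "0 \<le> n" and lam: "0 \<le> lam"
    and d: "0 \<le> d" "s * d \<le> t" and a: "0 \<le> a" "a \<le> d"
    and q: "t\<^sup>2 - 2 * n * t + 4 * mu * a \<le> 2 * lam * d"
  shows "d + a \<le> 4 * lam / s\<^sup>2 + 2 * n / s + n\<^sup>2 / (4 * mu)"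
proof -
  have "s * d + s * a \<le> 4 * (lam / s) + 2 * n + n\<^sup>2 / (4 * mu / s)"
    by (rule sum_bound_from_quadratic_normalised[of _ n _ _ t])
      (use assms in \<open>simp_all add: mult_left_mono\<close>)
  then have "(s * d + s * a) / s \<le> (4 * (lam / s) + 2 * n + n\<^sup>2 / (4 * mu / s)) / s"
    using s by (intro divide_right_mono) simp_all
  then show ?thesis
    using s mu by (simp add: add_divide_distrib power2_eq_square)
qed

theorem theorem5p6:
  fixes f :: "'m::finite \<Rightarrow> 'a::fd_complex_hilbert"
    and x u v :: 'a
    and y \<nu> :: "real ^ 'm"
    and lam mu A3 :: real
  assumes "0 \<le> lam" and "0 \<le> mu"
    and "is_frame f"
    and "y = alpha f x + \<nu>"
    and "assumption_A f"
    and "0 < A3"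
    and "\<forall>X\<in>S_set 1 1. \<forall>Y\<in>S_set 1 0.
           A3 * (nuclear_norm (\<lambda>w. X w - Y w))\<^sup>2 \<le> (norm (cal_A f X - cal_A f Y))\<^sup>2"
    and "J_obj f y u v lam mu \<le> J_obj f y x x lam mu"
  shows
    "nuclear_norm (\<lambda>w. sym_outer u v w - outer x x w)
       \<le> 2 * lam / A3 + 2 * sqrt (lam\<^sup>2 / A3\<^sup>2 + (norm \<nu>)\<^sup>2 / A3)
     \<and> 2 * lam / A3 + 2 * sqrt (lam\<^sup>2 / A3\<^sup>2 + (norm \<nu>)\<^sup>2 / A3)
       \<le> 4 * lam / A3 + 2 * norm \<nu> / sqrt A3
     \<and> (\<forall>(a1::real) (a2::real) (e1::'a) (e2::'a).
          0 \<le> a1 \<and> 0 \<le> a2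
          \<and> cinner e1 e1 = 1 \<and> cinner e2 e2 = 1 \<and> cinner e1 e2 = 0
          \<and> sym_outer u v = (\<lambda>w. a1 *\<^sub>R outer e1 e1 w - a2 *\<^sub>R outer e2 e2 w)
          \<longrightarrow>
          (\<forall>\<phi>0::real. cis \<phi>0 = cinner x e1 / complex_of_real (cmod (cinner x e1)) \<longrightarrow>
             (norm (x - (cis \<phi>0 * complex_of_real (sqrt a1)) *\<^sub>C e1))\<^sup>2
               \<le> nuclear_norm (\<lambda>w. sym_outer u v w - outer x x w) + a2)
          \<and> (0 < mu \<longrightarrow>
               nuclear_norm (\<lambda>w. sym_outer u v w - outer x x w) + a2
                 \<le> 4 * lam / A3 + 2 * norm \<nu> / sqrt A3
                   + (norm \<nu>)\<^sup>2 / (4 * mu) + lam * (norm x)\<^sup>2 / (2 * mu))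
          \<and> (J_obj f y u v lam mu \<le> J_obj f y 0 0 lam mu \<and> 0 < mu \<longrightarrow>
             (\<forall>\<phi>0::real. cis \<phi>0 = cinner x e1 / complex_of_real (cmod (cinner x e1)) \<longrightarrow>
                (norm (x - (cis \<phi>0 * complex_of_real (sqrt a1)) *\<^sub>C e1))\<^sup>2
                  \<le> 4 * lam / A3 + 2 * norm \<nu> / sqrt A3 + (norm \<nu>)\<^sup>2 / (4 * mu))))"
proof -
  let ?d = "nuclear_norm (\<lambda>w. sym_outer u v w - outer x x w)"
  let ?n = "norm \<nu>"
  let ?s = "sqrt A3"
  define t where "t = norm (cal_A f (sym_outer u v) - cal_A f (outer x x))"
  have s: "0 < ?s" "?s\<^sup>2 = A3"
    using \<open>0 < A3\<close> by simp_all
  have t: "0 \<le> t"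
    by (simp add: t_def)
  have d: "0 \<le> ?d"
    unfolding nuclear_norm_def by (rule sum_nonneg) simp
  have "A3 * ?d\<^sup>2 \<le> t\<^sup>2"
    unfolding t_def using assms(7) sym_outer_in_S_set outer_in_S_set by blast
  then have "(?s * ?d)\<^sup>2 \<le> t\<^sup>2"
    by (simp add: power_mult_distrib s)
  then have sd: "?s * ?d \<le> t"
    using t by (rule power2_le_imp_le)
  have basic: "(t - ?n)\<^sup>2 + lam * ((norm u)\<^sup>2 + (norm v)\<^sup>2) + mu * (norm (u - v))\<^sup>2
      \<le> ?n\<^sup>2 + 2 * lam * (norm x)\<^sup>2"
    unfolding t_def by (rule objective_comparison[OF assms(4,1,8)])
  \<comment> \<open>\<open>\<parallel>u\<parallel>\<^sup>2 + \<parallel>v\<parallel>\<^sup>2\<close> is at least twice the trace \<open>Re \<langle>u, v\<rangle>\<close>, so the gain in the penalty with weight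
     \<open>lam\<close> is controlled by the trace of the lifted error, hence by its nuclear norm\<close>
  have q: "t\<^sup>2 - 2 * ?n * t + mu * (norm (u - v))\<^sup>2 \<le> 2 * lam * ?d"
  proof -
    have "(norm x)\<^sup>2 - Re (cinner u v) \<le> ?d"
      using nuclear_norm_lift_error_ge[of 0 u v x] by (simp add: abs_le_iff)
    moreover have "2 * Re (cinner u v) \<le> (norm u)\<^sup>2 + (norm v)\<^sup>2"
      using norm_diff_square[of u v] zero_le_power2[of "norm (u - v)"] by linarith
    ultimately have "lam * (2 * (norm x)\<^sup>2 - ((norm u)\<^sup>2 + (norm v)\<^sup>2)) \<le> lam * (2 * ?d)"
      using \<open>0 \<le> lam\<close> by (intro mult_left_mono) linarith+
    then show ?thesis
      using basic by (simp add: power2_eq_square algebra_simps)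
  qed
  have "t\<^sup>2 - 2 * ?n * t \<le> 2 * lam * ?d"
    using q mult_nonneg_nonneg[OF \<open>0 \<le> mu\<close> zero_le_power2[of "norm (u - v)"]] by linarith
  then have d_le: "?d \<le> 2 * lam / A3 + 2 * ?n / ?s"
    using linear_bound_from_quadratic[OF s(1) sd t norm_ge_zero \<open>0 \<le> lam\<close>] s(2) by simp
  have "?n / ?s = sqrt (?n\<^sup>2 / A3)"
    by (simp add: real_sqrt_divide)
  also have "\<dots> \<le> sqrt (lam\<^sup>2 / A3\<^sup>2 + ?n\<^sup>2 / A3)"
    by (rule real_sqrt_le_mono) simp
  finally have lower: "2 * ?n / ?s \<le> 2 * sqrt (lam\<^sup>2 / A3\<^sup>2 + ?n\<^sup>2 / A3)"
    by simp
  have "sqrt (lam\<^sup>2 / A3\<^sup>2 + ?n\<^sup>2 / A3) \<le> sqrt (lam\<^sup>2 / A3\<^sup>2) + sqrt (?n\<^sup>2 / A3)"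
    by (rule sqrt_add_le_add_sqrt) (use \<open>0 < A3\<close> in simp_all)
  also have "\<dots> = lam / A3 + ?n / ?s"
    using \<open>0 \<le> lam\<close> \<open>0 < A3\<close> by (simp add: real_sqrt_divide)
  finally have upper: "2 * lam / A3 + 2 * sqrt (lam\<^sup>2 / A3\<^sup>2 + ?n\<^sup>2 / A3)
      \<le> 4 * lam / A3 + 2 * ?n / ?s"
    by simp
  show ?thesis
  proof (intro conjI allI impI; (elim conjE)?)
    show "?d \<le> 2 * lam / A3 + 2 * sqrt (lam\<^sup>2 / A3\<^sup>2 + ?n\<^sup>2 / A3)"
      using d_le lower by linarith
    show "2 * lam / A3 + 2 * sqrt (lam\<^sup>2 / A3\<^sup>2 + ?n\<^sup>2 / A3) \<le> 4 * lam / A3 + 2 * ?n / ?s"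
      by (rule upper)
    fix a1 a2 :: real and e1 e2 :: 'a
    assume "0 \<le> a1" "0 \<le> a2" "cinner e1 e1 = 1" "cinner e2 e2 = 1" "cinner e1 e2 = 0"
      "sym_outer u v = (\<lambda>w. a1 *\<^sub>R outer e1 e1 w - a2 *\<^sub>R outer e2 e2 w)"
    then interpret rank_two_decomposition u v e1 e2 a1 a2
      by unfold_locales
    show err: "(norm (x - (cis \<phi>0 * complex_of_real (sqrt a1)) *\<^sub>C e1))\<^sup>2 \<le> ?d + a2"
      if "cis \<phi>0 = cinner x e1 / complex_of_real (cmod (cinner x e1))" for \<phi>0
      using that by (rule estimate_error_le)
    have a2_mu: "4 * mu * a2 \<le> mu * (norm (u - v))\<^sup>2"
      using mult_left_mono[OF negative_part_le_distance \<open>0 \<le> mu\<close>] by simp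
    show "?d + a2 \<le> 4 * lam / A3 + 2 * ?n / ?s + ?n\<^sup>2 / (4 * mu) + lam * (norm x)\<^sup>2 / (2 * mu)"
      if "0 < mu"
    proof -
      have "0 \<le> (t - ?n)\<^sup>2 + lam * ((norm u)\<^sup>2 + (norm v)\<^sup>2)"
        using \<open>0 \<le> lam\<close> by simp
      then have "4 * mu * a2 \<le> ?n\<^sup>2 + 2 * lam * (norm x)\<^sup>2"
        using basic a2_mu by linarith
      then have "a2 \<le> ?n\<^sup>2 / (4 * mu) + lam * (norm x)\<^sup>2 / (2 * mu)"
        using that by (simp add: field_simps)
      then show ?thesis
        using d_le lower upper by linarith
    qed
    show "(norm (x - (cis \<phi>0 * complex_of_real (sqrt a1)) *\<^sub>C e1))\<^sup>2
        \<le> 4 * lam / A3 + 2 * ?n / ?s + ?n\<^sup>2 / (4 * mu)"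
      if "0 < mu" and phase: "cis \<phi>0 = cinner x e1 / complex_of_real (cmod (cinner x e1))" for \<phi>0
    proof -
      have "t\<^sup>2 - 2 * ?n * t + 4 * mu * a2 \<le> 2 * lam * ?d"
        using q a2_mu by linarith
      then have "?d + a2 \<le> 4 * lam / A3 + 2 * ?n / ?s + ?n\<^sup>2 / (4 * mu)"
        using sum_bound_from_quadratic[OF s(1) \<open>0 < mu\<close> norm_ge_zero \<open>0 \<le> lam\<close> d sd a2
            negative_part_le_nuclear_norm] s(2) by simp
      then show ?thesis
        using err[OF phase] by linarith
    qed
  qed
qed

end
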